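(* Let $n\ge 2$ be an integer, and let $\mathcal{T}=(A,M,B)$ be a $2$- and $(n-1)$-torsion free triangular algebra over a commutative unital ring $\mathcal{R}$, where $A$ and $B$ are two unital algebras and $M$ is a faithful $(A,B)$-bimodule. Let $e$ and $f=1-e$ be the idempotents of $\mathcal{T}$ corresponding to the units of $A$ and $B$. If one of the following statements holds: (i) $A=\mathcal{S}(A)$ and $B=\mathcal{S}(B)$; (ii) $\mathcal{T}=\mathcal{S}(\mathcal{T})$; (iii) $A=\mathcal{S}(A)$ and $\mathcal{Z}(A)=e\mathcal{Z}(\mathcal{T})e$; (iv) $B=\mathcal{S}(B)$ and $\mathcal{Z}(B)=f\mathcal{Z}(\mathcal{T})f$; (v) $\mathcal{Z}(A)=e\mathcal{Z}(\mathcal{T})e$ and $\mathcal{Z}(B)=f\mathcal{Z}(\mathcal{T})f$, and, when $n\ge 3$, $A$ or $B$ satisfies property (P) (defined in the context); then every Lie $n$-derivation on $\mathcal{T}$ is standard.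
   Context: The triangular algebra $\mathcal{T}=(A,M,B)$ is the algebra of matrices $\begin{pmatrix} a & m\\ 0& b\end{pmatrix}$ with $a\in A$, $m\in M$, $b\in B$ under matrix operations; $e=\begin{pmatrix}1&0\\0&0\end{pmatrix}$, $f=\begin{pmatrix}0&0\\0&1\end{pmatrix}$, and $A$, $M$, $B$ are identified with $e\mathcal{T}e$, $e\mathcal{T}f$, $f\mathcal{T}f$. $M$ is faithful: $aM=0$ implies $a=0$ for $a\in A$, and $Mb=0$ implies $b=0$ for $b\in B$. Linear means $\mathcal{R}$-linear; $\mathcal{Z}(\cdot)$ is the centre. For a positive integer $k$, $\mathcal{T}$ is $k$-torsion free if $kx=0$ implies $x=0$ for each $x\in\mathcal{T}$. $[x,y]=xy-yx$. For an algebra $\mathcal{B}$, $\mathcal{S}(\mathcal{B})$ is the subalgebra of $\mathcal{B}$ generated by all idempotents and all commutators of $\mathcal{B}$; $\mathcal{B}$ satisfies property (P) if for each $x\in\mathcal{B}$, $[x,\mathcal{B}]\subseteq\mathcal{Z}(\mathcal{B})$ implies $x\in\mathcal{Z}(\mathcal{B})$. Define $p_1(x_1)=x_1$ and $p_n(x_1,\dots,x_n)=[p_{n-1}(x_1,\dots,x_{n-1}),x_n]$ for $n\ge2$; for $n\ge 2$, $p_n(x_1,\dots,x_n)$ is called an $(n-1)$-th commutator. A linear map $\varphi:\mathcal{T}\to\mathcal{T}$ is a Lie $n$-derivation if $\varphi(p_n(x_1,\dots,x_n))=\sum_{i=1}^n p_n(x_1,\dots,x_{i-1},\varphi(x_i),x_{i+1},\dots,x_n)$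 for all $x_1,\dots,x_n\in\mathcal{T}$. A Lie $n$-derivation is standard if it equals $h+\tau$ with $h$ a derivation on $\mathcal{T}$ (linear, $h(xy)=h(x)y+xh(y)$) and $\tau$ a linear mapping from $\mathcal{T}$ into $\mathcal{Z}(\mathcal{T})$ vanishing on all $(n-1)$-th commutators of $\mathcal{T}$. *)

theory Defs
  imports Complex_Main "HOL-Library.Product_Plus"
begin

text \<open>The operations of an algebra over \<^typ>\<open>'r\<close> whose additive group is the type \<^typ>\<open>'x\<close>.
  The multiplication is a record field rather than a type class operation, because the
  multiplication of a triangular algebra depends on the bimodule actions.\<close>

record ('r, 'x) alg =
  scal :: "'r \<Rightarrow> 'x \<Rightarrow> 'x"
  mul :: "'x \<Rightarrow> 'x \<Rightarrow> 'x"
  unit_el :: 'x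

record ('r, 'a, 'm, 'b) bimod =
  bscal :: "'r \<Rightarrow> 'm \<Rightarrow> 'm"
  lact :: "'a \<Rightarrow> 'm \<Rightarrow> 'm"
  ract :: "'m \<Rightarrow> 'b \<Rightarrow> 'm"

text \<open>The zero algebra is allowed: \<^const>\<open>unit_el\<close> may be \<open>0\<close>.\<close>

locale unital_algebra =
  fixes A :: "('r::comm_ring_1, 'x::ab_group_add) alg"
  assumes module: "module (scal A)"
    and monoid: "monoid (mul A) (unit_el A)"
    and linear_left: "module_hom (scal A) (scal A) (\<lambda>x. mul A x y)"
    and linear_right: "module_hom (scal A) (scal A) (\<lambda>y. mul A x y)"

locale bimodule = A: unital_algebra A + B: unital_algebra B
  for A :: "('r::comm_ring_1, 'a::ab_group_add) alg"
    and B :: "('r, 'b::ab_group_add) alg" +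
  fixes M :: "('r, 'a, 'm::ab_group_add, 'b) bimod"
  assumes module: "module (bscal M)"
    and lact_linear_left: "module_hom (scal A) (bscal M) (\<lambda>a. lact M a m)"
    and lact_linear_right: "module_hom (bscal M) (bscal M) (\<lambda>m. lact M a m)"
    and ract_linear_left: "module_hom (bscal M) (bscal M) (\<lambda>m. ract M m b)"
    and ract_linear_right: "module_hom (scal B) (bscal M) (\<lambda>b. ract M m b)"
    and lact_mul: "lact M (mul A a a') m = lact M a (lact M a' m)"
    and lact_unit: "lact M (unit_el A) m = m"
    and ract_mul: "ract M m (mul B b b') = ract M (ract M m b) b'"
    and ract_unit: "ract M m (unit_el B) = m"
    and lact_ract: "ract M (lact M a m) b = lact M a (ract M m b)"

locale faithful_bimodule = bimodule +
  assumes faithful_left: "(\<And>m. lact M a m = 0) \<Longrightarrow> a = 0"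
    and faithful_right: "(\<And>m. ract M m b = 0) \<Longrightarrow> b = 0"

text \<open>The triple \<open>(a, m, b)\<close> stands for the matrix with rows \<open>(a, m)\<close> and \<open>(0, b)\<close>;
  addition of matrices is the componentwise addition of triples.\<close>

definition triangular ::
  "('r, 'a) alg \<Rightarrow> ('r, 'a, 'm::ab_group_add, 'b) bimod \<Rightarrow> ('r, 'b) alg \<Rightarrow> ('r, 'a \<times> 'm \<times> 'b) alg"
  where "triangular A M B =
    \<lparr>scal = (\<lambda>r (a, m, b). (scal A r a, bscal M r m, scal B r b)),
     mul = (\<lambda>(a, m, b) (a', m', b'). (mul A a a', lact M a m' + ract M m b', mul B b b')),
     unit_el = (unit_el A, 0, unit_el B)\<rparr>"

definition embA :: "'a \<Rightarrow> 'a \<times> 'm::ab_group_add \<times> 'b::ab_group_add"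
  where "embA a = (a, 0, 0)"

definition embB :: "'b \<Rightarrow> 'a::ab_group_add \<times> 'm::ab_group_add \<times> 'b"
  where "embB b = (0, 0, b)"

text \<open>The sum is the natural multiple \<open>k x\<close>.\<close>

definition torsion_free :: "nat \<Rightarrow> ('r, 'x::ab_group_add) alg \<Rightarrow> bool"
  where "torsion_free k T \<longleftrightarrow> (\<forall>x::'x. (\<Sum>i<k. x) = 0 \<longrightarrow> x = 0)"

definition centre :: "('r, 'x) alg \<Rightarrow> 'x set"
  where "centre A = {z. \<forall>x. mul A z x = mul A x z}"

text \<open>The corner \<open>p X p\<close> of a set \<open>X\<close>.\<close>

definition corner :: "('r, 'x) alg \<Rightarrow> 'x \<Rightarrow> 'x set \<Rightarrow> 'x set"
  where "corner A p X = (\<lambda>x. mul A (mul A p x) p) ` X"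

definition commutator :: "('r, 'x::ab_group_add) alg \<Rightarrow> 'x \<Rightarrow> 'x \<Rightarrow> 'x"
  where "commutator A x y = mul A x y - mul A y x"

definition subalgebra :: "('r::comm_ring_1, 'x::ab_group_add) alg \<Rightarrow> 'x set \<Rightarrow> bool"
  where "subalgebra A C \<longleftrightarrow>
    module.subspace (scal A) C \<and> (\<forall>x\<in>C. \<forall>y\<in>C. mul A x y \<in> C)"

text \<open>Subalgebras are not required to contain the unit, but it is itself an idempotent.\<close>

definition S_alg :: "('r::comm_ring_1, 'x::ab_group_add) alg \<Rightarrow> 'x set"
  where "S_alg A =
    subalgebra A hull ({x. mul A x x = x} \<union> {commutator A x y |x y. True})"

definition property_P :: "('r, 'x::ab_group_add) alg \<Rightarrow> bool"
  where "property_P A \<longleftrightarrow>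
    (\<forall>x. (\<forall>y. commutator A x y \<in> centre A) \<longrightarrow> x \<in> centre A)"

text \<open>The polynomial \<open>p\<^sub>n(x\<^sub>1, \<dots>, x\<^sub>n)\<close>. The arguments are given as a sequence, of which only the
  entries with indices \<open>1, \<dots>, n\<close> matter; the value for \<open>n = 0\<close> is a dummy.\<close>

fun lie_p :: "('r, 'x::ab_group_add) alg \<Rightarrow> nat \<Rightarrow> (nat \<Rightarrow> 'x) \<Rightarrow> 'x" where
  "lie_p A 0 x = 0"
| "lie_p A (Suc 0) x = x 1"
| "lie_p A (Suc (Suc n)) x = commutator A (lie_p A (Suc n) x) (x (Suc (Suc n)))"

definition lie_n_derivation ::
  "nat \<Rightarrow> ('r::comm_ring_1, 'x::ab_group_add) alg \<Rightarrow> ('x \<Rightarrow> 'x) \<Rightarrow> bool"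
  where "lie_n_derivation n T \<phi> \<longleftrightarrow>
    module_hom (scal T) (scal T) \<phi> \<and>
    (\<forall>x. \<phi> (lie_p T n x) = (\<Sum>i=1..n. lie_p T n (x(i := \<phi> (x i)))))"

definition derivation :: "('r::comm_ring_1, 'x::ab_group_add) alg \<Rightarrow> ('x \<Rightarrow> 'x) \<Rightarrow> bool"
  where "derivation T h \<longleftrightarrow>
    module_hom (scal T) (scal T) h \<and>
    (\<forall>x y. h (mul T x y) = mul T (h x) y + mul T x (h y))"

definition standard ::
  "nat \<Rightarrow> ('r::comm_ring_1, 'x::ab_group_add) alg \<Rightarrow> ('x \<Rightarrow> 'x) \<Rightarrow> bool"
  where "standard n T \<phi> \<longleftrightarrow>
    (\<exists>h \<tau>. derivation T h \<and>
      module_hom (scal T) (scal T) \<tau> \<and> range \<tau> \<subseteq> centre T \<and> (\<forall>x. \<tau> (lie_p T n x) = 0) \<and>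
      (\<forall>x. \<phi> x = h x + \<tau> x))"

lemma (in bimodule) unital_algebra_triangular: "unital_algebra (triangular A M B)"
proof -
  interpret mA: module "scal A" by (rule A.module)
  interpret mB: module "scal B" by (rule B.module)
  interpret mM: module "bscal M" by (rule module)
  have T: "module (scal (triangular A M B))"
    by unfold_locales
      (auto simp: triangular_def zero_prod_def mA.scale_right_distrib mA.scale_left_distrib
        mB.scale_right_distrib mB.scale_left_distrib mM.scale_right_distrib mM.scale_left_distrib)
  note homs = A.linear_left A.linear_right B.linear_left B.linear_right
    lact_linear_left lact_linear_right ract_linear_left ract_linear_right
  note adds = homs[THEN module_hom.add] and scales = homs[THEN module_hom.scale]
  interpret oA: monoid "mul A" "unit_el A" by (rule A.monoid)
  interpret oB: monoid "mul B" "unit_el B" by (rule B.monoid)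
  have zeros: "lact M a 0 = 0" "ract M 0 b = 0" for a b
    using module_hom.zero[OF lact_linear_right[of a]] module_hom.zero[OF ract_linear_left[of b]]
    by simp_all
  show ?thesis
    by (unfold_locales; (use T in \<open>simp add: module_def\<close>)?)
      (auto simp: triangular_def adds scales oA.assoc oB.assoc lact_mul ract_mul lact_ract
        lact_unit ract_unit zeros mM.scale_right_distrib mA.scale_right_distrib
        mB.scale_right_distrib mM.scale_left_distrib mA.scale_left_distrib
        mB.scale_left_distrib)
qed

lemma one_minus_embA:
  "unit_el (triangular A M B) - embA (unit_el A) = embB (unit_el B)"
  by (simp add: triangular_def embA_def embB_def)

end

theory Submission
  imports Defs
begin

text \<open>
  Let \<open>f\<close> be the idempotent of the unit of \<open>B\<close>. Since \<open>[m, f] = m\<close> for \<open>m \<in> M\<close>, every element of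
  \<open>M\<close> is \<open>p\<^sub>n(m, f, \<dots>, f)\<close>, and applying a Lie \<open>n\<close>-derivation \<open>\<phi>\<close> to this identity gives
  \<open>(n - 1) [m, \<phi> f] = 0\<close>. As the algebra has no \<open>(n - 1)\<close>-torsion, \<open>\<phi> f\<close> commutes with \<open>M\<close>, and an
  inner derivation added to \<open>\<phi>\<close> makes \<open>\<phi> f\<close> central (\<open>standard_reduction_central_f\<close>).

  After this normalisation trailing arguments \<open>f\<close> contribute nothing to the Leibniz rule for \<open>p\<^sub>n\<close>,
  so \<open>\<phi>\<close> satisfies the Leibniz rule for each commutator \<open>[y, z]\<close> for which all terms of the rule
  lie in \<open>M\<close> (\<open>\<phi>_commutator_in_M\<close>). This yields \<open>\<phi>(M) \<subseteq> M\<close> and \<open>\<phi>(A), \<phi>(B) \<subseteq> A + B\<close>, say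
  \<open>\<phi> a = \<alpha> a + \<alpha>' a\<close>, \<open>\<phi> b = \<beta>' b + \<beta> b\<close> and \<open>\<phi> m = \<mu> m\<close>, with

    \<open>\<mu>(a m) = (\<alpha> a) m - m (\<alpha>' a) + a (\<mu> m)\<close>  and  \<open>\<mu>(m b) = (\<mu> m) b + m (\<beta> b) - (\<beta>' b) m\<close>.

  If every \<open>\<alpha>' a\<close> and every \<open>\<beta>' b\<close> is a component of a central element, the central parts can be
  split off, the remaining formulas say that \<open>\<mu>\<close> intertwines the actions like a derivation, and
  faithfulness makes the rest of \<open>\<phi>\<close> a derivation (\<open>standard_if_central_components\<close>).

  There are two sources of centrality. First, expanding \<open>\<mu>(a a' m)\<close> in two ways shows that the
  operators \<open>m \<mapsto> m (\<alpha>' a)\<close> satisfy a Leibniz rule modulo the operators \<open>m \<mapsto> c m\<close> with \<open>c \<in> A\<close>;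
  this forces \<open>m (\<alpha>' a) = c m\<close> for idempotents and commutators \<open>a\<close>, hence on all of \<open>S(A)\<close>
  (\<open>S_alg_operators_in_image\<close>). Secondly, \<open>[a, b] = 0\<close> implies that \<open>[a, \<beta>' b] + [\<alpha>' a, b]\<close> is
  central, and even zero for \<open>n = 2\<close> (\<open>commutators_central\<close>). So centrality of the \<open>\<alpha>' a\<close> in \<open>B\<close> and
  of the \<open>\<beta>' b\<close> in \<open>A\<close> are equivalent, property (P) implies either of them, and the hypotheses on
  \<open>Z(A)\<close> and \<open>Z(B)\<close> extend a central element of a corner to one of the whole algebra.
\<close>

section \<open>Commutators in a unital algebra\<close>

context unital_algebra
begin

lemmas mul_add_left = module_hom.add[OF linear_left]
  and mul_add_right = module_hom.add[OF linear_right]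
  and mul_diff_left = module_hom.diff[OF linear_left]
  and mul_diff_right = module_hom.diff[OF linear_right]
  and mul_scal_left = module_hom.scale[OF linear_left]
  and mul_scal_right = module_hom.scale[OF linear_right]
  and mul_zero_left = module_hom.zero[OF linear_left]
  and mul_zero_right = module_hom.zero[OF linear_right]
  and mul_assoc = semigroup.assoc[OF monoid.axioms(1)[OF monoid]]
  and mul_unit_left = monoid.left_neutral[OF monoid]
  and mul_unit_right = monoid.right_neutral[OF monoid]

lemma commutator_add_left: "commutator A (x + y) z = commutator A x z + commutator A y z"
  by (simp add: commutator_def mul_add_left mul_add_right)

lemma commutator_add_right: "commutator A z (x + y) = commutator A z x + commutator A z y"
  by (simp add: commutator_def mul_add_left mul_add_right)

lemma commutator_zero_left: "commutator A 0 x = 0"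
  by (simp add: commutator_def mul_zero_left mul_zero_right)

lemma commutator_sum_left: "commutator A (\<Sum>i\<in>I. g i) y = (\<Sum>i\<in>I. commutator A (g i) y)"
  by (induction I rule: infinite_finite_induct)
    (simp_all add: commutator_zero_left commutator_add_left)

lemma commutator_centre_left: "z \<in> centre A \<Longrightarrow> commutator A z x = 0"
  by (simp add: commutator_def centre_def)

lemma commutator_centre_right: "z \<in> centre A \<Longrightarrow> commutator A x z = 0"
  by (simp add: commutator_def centre_def)

lemma centre_iff_commutator: "z \<in> centre A \<longleftrightarrow> (\<forall>x. commutator A x z = 0)"
  by (auto simp: commutator_def centre_def)

lemma lie_p_cong: "(\<And>i. 1 \<le> i \<Longrightarrow> i \<le> k \<Longrightarrow> x i = y i) \<Longrightarrow> lie_p A k x = lie_p A k y"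
proof (induction k)
  case (Suc k)
  then show ?case by (cases k) auto
qed simp

lemma lie_p_Suc: "k \<ge> 1 \<Longrightarrow> lie_p A (Suc k) x = commutator A (lie_p A k x) (x (Suc k))"
  by (cases k) auto

lemma lie_p_upd_beyond: "i > k \<Longrightarrow> lie_p A k (x(i := u)) = lie_p A k x"
  by (rule lie_p_cong) auto

lemma lie_p_add:
  assumes "1 \<le> i" "i \<le> k"
  shows "lie_p A k (x(i := u + v)) = lie_p A k (x(i := u)) + lie_p A k (x(i := v))"
  using assms(2)
proof (induction k rule: dec_induct)
  case base
  from assms(1) obtain j where "i = Suc j" by (cases i) auto
  then show ?case
    by (cases j) (simp_all add: lie_p_upd_beyond del: fun_upd_apply,
        simp_all add: commutator_add_right)
next
  case (step k)
  then show ?case using assms(1) by (simp add: lie_p_Suc commutator_add_left)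
qed

text \<open>The bound \<open>k \<ge> 2\<close> is needed for \<open>i = 1\<close>: a central first argument is only killed by the
  commutator with the second one.\<close>

lemma lie_p_centre:
  assumes "k \<ge> 2" "1 \<le> i" "i \<le> k" "x i \<in> centre A"
  shows "lie_p A k x = 0"
proof -
  have "lie_p A j x = 0" if "max i 2 \<le> j" for j
    using that
  proof (induction j rule: dec_induct)
    case base
    consider "i = 1" | j where "i = Suc (Suc j)"
      using \<open>1 \<le> i\<close> by (metis One_nat_def Suc_le_D not0_implies_Suc)
    then show ?case
      using \<open>x i \<in> centre A\<close>
      by cases (simp_all add: numeral_2_eq_2 commutator_centre_left commutator_centre_right)
  next
    case (step j)
    then show ?case by (simp add: lie_p_Suc commutator_zero_left)
  qed
  then show ?thesis using assms by simp
qed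

lemma derivation_commutator:
  assumes "derivation A h"
  shows "h (commutator A x y) = commutator A (h x) y + commutator A x (h y)"
proof -
  have "module_hom (scal A) (scal A) h" and "\<And>x y. h (mul A x y) = mul A (h x) y + mul A x (h y)"
    using assms by (auto simp: derivation_def)
  then show ?thesis by (simp add: commutator_def module_hom.diff)
qed

lemma derivation_lie_p:
  assumes "derivation A h" and "k \<ge> 1"
  shows "h (lie_p A k x) = (\<Sum>i=1..k. lie_p A k (x(i := h (x i))))"
  using assms(2)
proof (induction k rule: dec_induct)
  case base
  show ?case by simp
next
  case (step k)
  have "h (lie_p A (Suc k) x)
    = commutator A (h (lie_p A k x)) (x (Suc k)) + commutator A (lie_p A k x) (h (x (Suc k)))"
    using step.hyps by (simp add: lie_p_Suc derivation_commutator[OF assms(1)])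
  also have "commutator A (h (lie_p A k x)) (x (Suc k))
    = (\<Sum>i=1..k. lie_p A (Suc k) (x(i := h (x i))))"
    unfolding step.IH commutator_sum_left
    using step.hyps by (intro sum.cong[OF refl]) (simp add: lie_p_Suc)
  also have "commutator A (lie_p A k x) (h (x (Suc k)))
    = lie_p A (Suc k) (x(Suc k := h (x (Suc k))))"
    using step.hyps by (simp add: lie_p_Suc lie_p_upd_beyond)
  finally show ?case by (simp del: fun_upd_apply)
qed

lemma derivation_lie_n_derivation: "derivation A h \<Longrightarrow> n \<ge> 1 \<Longrightarrow> lie_n_derivation n A h"
  using derivation_lie_p by (auto simp: lie_n_derivation_def derivation_def)

lemma derivation_inner: "derivation A (\<lambda>x. commutator A x c)"
proof -
  interpret m: module "scal A" by (rule module)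
  show ?thesis
    unfolding derivation_def
    by (auto intro!: module_hom.intro module module_hom_axioms.intro
      simp: commutator_def mul_add_left mul_add_right mul_diff_left mul_diff_right
        mul_scal_left mul_scal_right m.scale_right_diff_distrib mul_assoc)
qed

lemma module_hom_plus:
  assumes "module_hom (scal A) (scal A) g" "module_hom (scal A) (scal A) h"
  shows "module_hom (scal A) (scal A) (\<lambda>x. g x + h x)"
  using assms module_pair.module_hom_add[OF module_pair.intro[OF module module]] by blast

lemma module_hom_minus:
  assumes "module_hom (scal A) (scal A) g" "module_hom (scal A) (scal A) h"
  shows "module_hom (scal A) (scal A) (\<lambda>x. g x - h x)"
  using assms module_pair.module_hom_sub[OF module_pair.intro[OF module module]] by blast

lemma derivation_diff:
  assumes "derivation A g" "derivation A h"
  shows "derivation A (\<lambda>x. g x - h x)"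
  using assms module_hom_minus[of g h]
  by (simp add: derivation_def mul_diff_left mul_diff_right)

lemma lie_n_derivation_add:
  assumes "lie_n_derivation n A g" "lie_n_derivation n A h"
  shows "lie_n_derivation n A (\<lambda>x. g x + h x)"
  using assms module_hom_plus[of g h]
  by (simp add: lie_n_derivation_def lie_p_add sum.distrib)

text \<open>The difference \<open>\<phi> - h\<close> satisfies the Leibniz rule for \<open>p\<^sub>n\<close>, in which every summand
  contains a central argument.\<close>

lemma standardI:
  assumes "n \<ge> 2" and \<phi>: "lie_n_derivation n A \<phi>" and h: "derivation A h"
    and central: "\<And>x. \<phi> x - h x \<in> centre A"
  shows "standard n A \<phi>"
proof -
  have "\<phi> (lie_p A n x) - h (lie_p A n x) = 0" for x
  proof -
    have "\<phi> (lie_p A n x) = (\<Sum>i=1..n. lie_p A n (x(i := h (x i) + (\<phi> (x i) - h (x i)))))"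
      using \<phi> by (simp add: lie_n_derivation_def)
    also have "\<dots> = (\<Sum>i=1..n. lie_p A n (x(i := h (x i))))"
    proof (rule sum.cong[OF refl])
      fix i assume i: "i \<in> {1..n}"
      have "lie_p A n (x(i := \<phi> (x i) - h (x i))) = 0"
        using i \<open>n \<ge> 2\<close> central by (intro lie_p_centre[of n i]) auto
      then show "lie_p A n (x(i := h (x i) + (\<phi> (x i) - h (x i)))) = lie_p A n (x(i := h (x i)))"
        using i lie_p_add[of i n x "h (x i)" "\<phi> (x i) - h (x i)"] by (simp del: fun_upd_apply)
    qed
    also have "\<dots> = h (lie_p A n x)"
      using derivation_lie_p[OF h] \<open>n \<ge> 2\<close> by simp
    finally show ?thesis by simp
  qed
  moreover have "module_hom (scal A) (scal A) (\<lambda>x. \<phi> x - h x)"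
    using \<phi> h by (intro module_hom_minus) (auto simp: lie_n_derivation_def derivation_def)
  ultimately show ?thesis
    unfolding standard_def using h central
    by (intro exI[of _ h] exI[of _ "\<lambda>x. \<phi> x - h x"]) auto
qed

section \<open>Algebras generated by idempotents and commutators\<close>

lemma S_alg_subset:
  assumes "subalgebra A U"
    and "\<And>x. mul A x x = x \<Longrightarrow> x \<in> U"
    and "\<And>x y. commutator A x y \<in> U"
  shows "S_alg A \<subseteq> U"
  unfolding S_alg_def by (rule hull_minimal) (use assms in auto)

text \<open>All operators \<open>D a\<close> on a module are shown to be of the form \<open>\<rho> c\<close>, when \<open>D\<close> satisfies a
  Leibniz rule modulo the image of \<open>\<rho>\<close>. The set of such \<open>a\<close> is a subalgebra. The error terms of
  the rule are symmetric in the two factors and cancel for a commutator. For an idempotent \<open>a\<close>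
  the rule reads \<open>(1 - 2 \<rho> a) D a = \<rho> c\<close>, and \<open>1 - 2 \<rho> a\<close> is its own inverse.
  The existential form of \<open>comp\<close> covers left actions and right actions alike, where the product of
  the two factors is taken in opposite orders.\<close>

lemma S_alg_operators_in_image:
  fixes \<rho> D :: "'x \<Rightarrow> 'm::ab_group_add \<Rightarrow> 'm"
  assumes S: "S_alg A = UNIV"
    and hom_\<rho>: "\<And>m. module_hom (scal A) s (\<lambda>a. \<rho> a m)"
    and hom_m: "\<And>a. module_hom s s (\<rho> a)"
    and hom_D: "\<And>m. module_hom (scal A) s (\<lambda>a. D a m)"
    and square: "\<And>a m. \<rho> (mul A a a) m = \<rho> a (\<rho> a m)"
    and comp: "\<And>a b. \<exists>c. \<forall>m. \<rho> a (\<rho> b m) = \<rho> c m"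
    and leibniz: "\<And>a b. \<exists>c. \<forall>m. D (mul A a b) m - \<rho> b (D a m) - \<rho> a (D b m) = \<rho> c m"
  shows "\<exists>c. \<forall>m. D a m = \<rho> c m"
proof -
  define U where "U = {a. \<exists>c. \<forall>m. D a m = \<rho> c m}"
  note hom_simps = hom_\<rho>[THEN module_hom.add] hom_\<rho>[THEN module_hom.diff]
    hom_\<rho>[THEN module_hom.scale] hom_\<rho>[THEN module_hom.zero]
    hom_m[THEN module_hom.add] hom_m[THEN module_hom.diff]
    hom_D[THEN module_hom.add] hom_D[THEN module_hom.diff]
    hom_D[THEN module_hom.scale] hom_D[THEN module_hom.zero]
  have "module.subspace (scal A) U"
  proof (rule module.subspaceI[OF module])
    show "0 \<in> U"
      unfolding U_def by (auto simp: hom_simps intro!: exI[of _ 0])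
    show "x + y \<in> U" if "x \<in> U" "y \<in> U" for x y
      using that unfolding U_def by (auto simp: hom_simps) (metis hom_simps(1))
    show "scal A r x \<in> U" if "x \<in> U" for r x
      using that unfolding U_def by (auto simp: hom_simps) (metis hom_simps(3))
  qed
  moreover have "mul A x y \<in> U" if xy: "x \<in> U" "y \<in> U" for x y
  proof -
    from xy obtain c d where c: "\<And>m. D x m = \<rho> c m" and d: "\<And>m. D y m = \<rho> d m"
      unfolding U_def by blast
    obtain g where g: "\<And>m. D (mul A x y) m - \<rho> y (D x m) - \<rho> x (D y m) = \<rho> g m"
      using leibniz by blast
    obtain p q where p: "\<And>m. \<rho> y (\<rho> c m) = \<rho> p m" and q: "\<And>m. \<rho> x (\<rho> d m) = \<rho> q m"
      using comp by meson
    have "D (mul A x y) m = \<rho> (g + p + q) m" for m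
      using g[of m] by (simp add: hom_simps c d p q algebra_simps)
    then show ?thesis unfolding U_def by blast
  qed
  ultimately have "subalgebra A U" by (simp add: subalgebra_def)
  moreover have "x \<in> U" if idem: "mul A x x = x" for x
  proof -
    obtain g where "\<forall>m. D (mul A x x) m - \<rho> x (D x m) - \<rho> x (D x m) = \<rho> g m"
      using leibniz by blast
    then have g: "D x m - \<rho> x (D x m) - \<rho> x (D x m) = \<rho> g m" for m
      by (simp add: idem)
    obtain p where p: "\<And>m. \<rho> x (\<rho> g m) = \<rho> p m"
      using comp by blast
    have "D x m = \<rho> (g - p - p) m" for m
    proof -
      \<comment> \<open>Since \<open>\<rho> x\<close> is idempotent, applying it to the rule merges its three terms into one.\<close>
      have "- \<rho> x (D x m) = \<rho> p m"
        using arg_cong[OF g[of m], of "\<rho> x"] square[of x] by (simp add: hom_simps idem p)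
      then have "\<rho> x (D x m) = - \<rho> p m"
        by (metis minus_minus)
      then show ?thesis
        using g[of m] by (simp add: hom_simps algebra_simps)
    qed
    then show ?thesis unfolding U_def by blast
  qed
  moreover have "commutator A x y \<in> U" for x y
  proof -
    obtain g g' where "\<And>m. D (mul A x y) m - \<rho> y (D x m) - \<rho> x (D y m) = \<rho> g m"
      and "\<And>m. D (mul A y x) m - \<rho> x (D y m) - \<rho> y (D x m) = \<rho> g' m"
      using leibniz by meson
    then have "D (commutator A x y) m = \<rho> (g - g') m" for m
      by (simp add: commutator_def hom_simps flip: \<open>\<And>m. _ = \<rho> g m\<close> \<open>\<And>m. _ = \<rho> g' m\<close>)
    then show ?thesis unfolding U_def by blast
  qed
  ultimately have "S_alg A \<subseteq> U" by (rule S_alg_subset)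
  then show ?thesis using S unfolding U_def by auto
qed

end

text \<open>Surjective homomorphisms preserve idempotents and commutators, so the preimage of
  \<open>S_alg C\<close> is a subalgebra that contains \<open>S_alg A\<close>.\<close>

lemma S_alg_surj_hom:
  assumes A: "unital_algebra A" and C: "unital_algebra C"
    and hom: "module_hom (scal A) (scal C) \<pi>"
    and mult: "\<And>x y. \<pi> (mul A x y) = mul C (\<pi> x) (\<pi> y)"
    and "surj \<pi>" and S: "S_alg A = UNIV"
  shows "S_alg C = UNIV"
proof -
  have "subalgebra C (S_alg C)"
    unfolding S_alg_def
  proof (rule hull_in)
    interpret C: module "scal C" by (rule unital_algebra.module[OF C])
    show "subalgebra C (\<Inter> F)" if "\<forall>V\<in>F. subalgebra C V" for F
      using that unfolding subalgebra_def by (auto intro!: C.subspace_Inter)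
  qed
  then have "subalgebra A (\<pi> -` S_alg C)"
    unfolding subalgebra_def using module_hom.subspace_vimage[OF hom] by (auto simp: mult)
  moreover have gen: "{x. mul C x x = x} \<union> {commutator C x y |x y. True} \<subseteq> S_alg C"
    unfolding S_alg_def by (rule hull_subset)
  have "x \<in> \<pi> -` S_alg C" if "mul A x x = x" for x
    using gen that mult[of x x] by auto
  moreover have "\<pi> (commutator A x y) = commutator C (\<pi> x) (\<pi> y)" for x y
    by (simp add: commutator_def mult module_hom.diff[OF hom])
  then have "commutator A x y \<in> \<pi> -` S_alg C" for x y
    using gen by simp blast
  ultimately have "S_alg A \<subseteq> \<pi> -` S_alg C"
    by (intro unital_algebra.S_alg_subset[OF A])
  then show ?thesis using S \<open>surj \<pi>\<close> by (auto simp: surj_def) (metis UNIV_I subsetD vimageE)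
qed

section \<open>The triangular algebra\<close>

sublocale bimodule \<subseteq> T: unital_algebra "triangular A M B"
  by (rule unital_algebra_triangular)

context bimodule
begin

abbreviation T :: "('r, 'a \<times> 'm \<times> 'b) alg"
  where "T \<equiv> triangular A M B"

abbreviation f :: "'a \<times> 'm \<times> 'b"
  where "f \<equiv> embB (unit_el B)"

abbreviation embM :: "'m \<Rightarrow> 'a \<times> 'm \<times> 'b"
  where "embM m \<equiv> (0, m, 0)"

lemmas act_simps =
  lact_linear_left[THEN module_hom.add] lact_linear_left[THEN module_hom.diff]
  lact_linear_left[THEN module_hom.neg]
  lact_linear_left[THEN module_hom.scale] lact_linear_left[THEN module_hom.zero]
  lact_linear_right[THEN module_hom.add] lact_linear_right[THEN module_hom.diff]
  lact_linear_right[THEN module_hom.neg]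
  lact_linear_right[THEN module_hom.scale] lact_linear_right[THEN module_hom.zero]
  ract_linear_left[THEN module_hom.add] ract_linear_left[THEN module_hom.diff]
  ract_linear_left[THEN module_hom.neg]
  ract_linear_left[THEN module_hom.scale] ract_linear_left[THEN module_hom.zero]
  ract_linear_right[THEN module_hom.add] ract_linear_right[THEN module_hom.diff]
  ract_linear_right[THEN module_hom.neg]
  ract_linear_right[THEN module_hom.scale] ract_linear_right[THEN module_hom.zero]
  lact_mul lact_unit ract_mul ract_unit lact_ract

lemma mul_triangular:
  "mul T (a, m, b) (a', m', b') = (mul A a a', lact M a m' + ract M m b', mul B b b')"
  by (simp add: triangular_def)

lemma scal_triangular: "scal T r (a, m, b) = (scal A r a, bscal M r m, scal B r b)"
  by (simp add: triangular_def)

lemma commutator_triangular: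
  "commutator T (a, m, b) (a', m', b') =
    (commutator A a a', lact M a m' + ract M m b' - lact M a' m - ract M m' b, commutator B b b')"
  by (simp add: commutator_def mul_triangular)

lemma commutator_f: "commutator T (a, m, b) f = embM m"
  by (simp add: embB_def commutator_triangular act_simps)
    (simp add: commutator_def A.mul_zero_left A.mul_zero_right B.mul_unit_left B.mul_unit_right)

lemma commutator_embM_left: "commutator T (embM m) t \<in> range embM"
  by (cases t) (simp add: commutator_triangular A.commutator_zero_left B.commutator_zero_left)

lemma commutator_embM_right: "commutator T t (embM m) \<in> range embM"
  by (cases t) (simp add: commutator_triangular, simp add: commutator_def
      A.mul_zero_left A.mul_zero_right B.mul_zero_left B.mul_zero_right)

text \<open>Trailing arguments \<open>f\<close> act on \<open>M\<close> as the identity. This turns \<open>p\<^sub>n\<close> into shorter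
  commutators.\<close>

lemma lie_p_tail_f:
  assumes "k \<le> n" "1 \<le> k" "lie_p T k x \<in> range embM" "\<And>i. k < i \<Longrightarrow> i \<le> n \<Longrightarrow> x i = f"
  shows "lie_p T n x = lie_p T k x"
  using assms(1,4)
proof (induction n rule: dec_induct)
  case (step j)
  then have "lie_p T (Suc j) x = commutator T (lie_p T k x) f"
    using assms(2) by (simp add: T.lie_p_Suc)
  then show ?case using assms(3) by (auto simp: commutator_f)
qed simp

end

context faithful_bimodule
begin

lemma lact_cancel: "(\<And>m. lact M a m = lact M a' m) \<Longrightarrow> a = a'"
  using faithful_left[of "a - a'"] by (simp add: act_simps)

lemma ract_cancel: "(\<And>m. ract M m b = ract M m b') \<Longrightarrow> b = b'"
  using faithful_right[of "b - b'"] by (simp add: act_simps)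

lemma mem_centre_T_iff: "(a, m, b) \<in> centre T \<longleftrightarrow> m = 0 \<and> (\<forall>m'. lact M a m' = ract M m' b)"
proof
  assume z: "(a, m, b) \<in> centre T"
  then have "mul T (a, m, b) (unit_el A, 0, 0) = mul T (unit_el A, 0, 0) (a, m, b)"
    and "mul T (a, m, b) (embM m') = mul T (embM m') (a, m, b)" for m'
    by (simp_all add: centre_def)
  then show "m = 0 \<and> (\<forall>m'. lact M a m' = ract M m' b)"
    by (simp add: mul_triangular act_simps)
next
  assume *: "m = 0 \<and> (\<forall>m'. lact M a m' = ract M m' b)"
  then have "mul A a a' = mul A a' a" for a'
    by (intro lact_cancel) (simp add: act_simps flip: lact_ract)
  moreover from * have "mul B b b' = mul B b' b" for b'
    by (intro ract_cancel) (simp add: act_simps, metis lact_ract)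
  ultimately show "(a, m, b) \<in> centre T"
    using * by (auto simp: centre_def mul_triangular act_simps)
qed

lemma centre_T_imp_centre_A: "(a, m, b) \<in> centre T \<Longrightarrow> a \<in> centre A"
  by (auto simp: centre_def mul_triangular)

lemma centre_T_imp_centre_B: "(a, m, b) \<in> centre T \<Longrightarrow> b \<in> centre B"
  by (auto simp: centre_def mul_triangular)

lemma corner_e_centre:
  assumes "embA ` centre A = corner T (embA (unit_el A)) (centre T)" and "a \<in> centre A"
  shows "\<exists>b. (a, 0, b) \<in> centre T"
proof -
  have "embA a \<in> corner T (embA (unit_el A)) (centre T)"
    using assms by blast
  then obtain c m b where z: "(c, m, b) \<in> centre T"
    and "embA a = mul T (mul T (embA (unit_el A)) (c, m, b)) (embA (unit_el A))"
    by (auto simp: corner_def)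
  then have "a = c"
    by (simp add: embA_def mul_triangular A.mul_unit_left A.mul_unit_right)
  moreover have "m = 0" using z by (simp add: mem_centre_T_iff)
  ultimately show ?thesis using z by auto
qed

lemma corner_f_centre:
  assumes "embB ` centre B = corner T f (centre T)" and "b \<in> centre B"
  shows "\<exists>a. (a, 0, b) \<in> centre T"
proof -
  have "embB b \<in> corner T f (centre T)"
    using assms by blast
  then obtain a m c where z: "(a, m, c) \<in> centre T"
    and "embB b = mul T (mul T f (a, m, c)) f"
    by (auto simp: corner_def)
  then have "b = c"
    by (simp add: embB_def mul_triangular B.mul_unit_left B.mul_unit_right)
  moreover have "m = 0" using z by (simp add: mem_centre_T_iff)
  ultimately show ?thesis using z by auto
qed

text \<open>By faithfulness, \<open>\<gamma> a\<close> is determined by its action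
  \<open>(\<gamma> a) m = \<mu> (a m) - a (\<mu> m)\<close>, that is, by the commutator of \<open>\<mu>\<close> with the action of \<open>a\<close>.
  So \<open>\<gamma>\<close> inherits linearity and the Leibniz rule; the same holds for \<open>\<delta>\<close>.\<close>

lemma derivation_of_components:
  assumes \<mu>: "module_hom (bscal M) (bscal M) \<mu>"
    and \<gamma>: "\<And>a m. \<mu> (lact M a m) = lact M (\<gamma> a) m + lact M a (\<mu> m)"
    and \<delta>: "\<And>m b. \<mu> (ract M m b) = ract M (\<mu> m) b + ract M m (\<delta> b)"
  shows "derivation T (\<lambda>(a, m, b). (\<gamma> a, \<mu> m, \<delta> b))"
proof -
  interpret mM: module "bscal M" by (rule module)
  note \<mu>_simps = module_hom.add[OF \<mu>] module_hom.scale[OF \<mu>]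
  have \<gamma>': "lact M (\<gamma> a) m = \<mu> (lact M a m) - lact M a (\<mu> m)" for a m
    by (simp add: \<gamma>)
  have \<delta>': "ract M m (\<delta> b) = \<mu> (ract M m b) - ract M (\<mu> m) b" for b m
    by (simp add: \<delta>)
  have "\<gamma> (a + a') = \<gamma> a + \<gamma> a'" for a a'
    by (rule lact_cancel) (simp add: act_simps \<gamma>' \<mu>_simps)
  moreover have "\<gamma> (scal A r a) = scal A r (\<gamma> a)" for r a
    by (rule lact_cancel) (simp add: act_simps \<gamma>' \<mu>_simps mM.scale_right_diff_distrib)
  moreover have "\<gamma> (mul A a a') = mul A (\<gamma> a) a' + mul A a (\<gamma> a')" for a a'
    by (rule lact_cancel) (simp add: act_simps \<gamma>' \<mu>_simps)
  moreover have "\<delta> (b + b') = \<delta> b + \<delta> b'" for b b'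
    by (rule ract_cancel) (simp add: act_simps \<delta>' \<mu>_simps)
  moreover have "\<delta> (scal B r b) = scal B r (\<delta> b)" for r b
    by (rule ract_cancel) (simp add: act_simps \<delta>' \<mu>_simps mM.scale_right_diff_distrib)
  moreover have "\<delta> (mul B b b') = mul B (\<delta> b) b' + mul B b (\<delta> b')" for b b'
    by (rule ract_cancel) (simp add: act_simps \<delta>' \<mu>_simps)
  ultimately show ?thesis
    unfolding derivation_def
    by (auto intro!: module_hom.intro T.module module_hom_axioms.intro
      simp: mul_triangular scal_triangular \<mu>_simps \<gamma> \<delta> algebra_simps)
qed

end

section \<open>Lie derivations that send \<open>f\<close> into the centre\<close>

locale lie_derivation_central_f = faithful_bimodule A B M
  for A :: "('r::comm_ring_1, 'a::ab_group_add) alg"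
    and B :: "('r, 'b::ab_group_add) alg"
    and M :: "('r, 'a, 'm::ab_group_add, 'b) bimod" +
  fixes n :: nat and \<phi> :: "'a \<times> 'm \<times> 'b \<Rightarrow> 'a \<times> 'm \<times> 'b"
  assumes two_le_n: "n \<ge> 2"
    and lie: "lie_n_derivation n T \<phi>"
    and \<phi>_f: "\<phi> f \<in> centre T"
begin

lemma \<phi>_hom: "module_hom (scal T) (scal T) \<phi>"
  using lie by (simp add: lie_n_derivation_def)

lemmas \<phi>_add = module_hom.add[OF \<phi>_hom]
  and \<phi>_scal = module_hom.scale[OF \<phi>_hom]
  and \<phi>_zero = module_hom.zero[OF \<phi>_hom]

text \<open>The summands with index beyond \<open>k\<close> have the central argument \<open>\<phi> f\<close>.\<close>

lemma \<phi>_lie_p_tail_f: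
  assumes "k \<le> n" "\<And>i. k < i \<Longrightarrow> i \<le> n \<Longrightarrow> x i = f"
  shows "\<phi> (lie_p T n x) = (\<Sum>i=1..k. lie_p T n (x(i := \<phi> (x i))))"
proof -
  have "\<phi> (lie_p T n x) = (\<Sum>i=1..n. lie_p T n (x(i := \<phi> (x i))))"
    using lie by (simp add: lie_n_derivation_def)
  also have "\<dots> = (\<Sum>i=1..k. lie_p T n (x(i := \<phi> (x i))))"
  proof (rule sum.mono_neutral_right)
    show "\<forall>i\<in>{1..n} - {1..k}. lie_p T n (x(i := \<phi> (x i))) = 0"
    proof
      fix i assume "i \<in> {1..n} - {1..k}"
      then show "lie_p T n (x(i := \<phi> (x i))) = 0"
        using assms(2)[of i] \<phi>_f two_le_n by (intro T.lie_p_centre[of n i]) auto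
    qed
  qed (use assms(1) in auto)
  finally show ?thesis .
qed

text \<open>The commutators in question do not change under further commutators with \<open>f\<close>, so they are
  the values of \<open>p\<^sub>n\<close> at \<open>(y, z, f, \<dots>, f)\<close> and its modifications.\<close>

lemma \<phi>_commutator_in_M:
  assumes "commutator T y z \<in> range embM" "commutator T (\<phi> y) z \<in> range embM"
    and "commutator T y (\<phi> z) \<in> range embM"
  shows "\<phi> (commutator T y z) = commutator T (\<phi> y) z + commutator T y (\<phi> z)"
proof -
  define x where "x = (\<lambda>_::nat. f)(1 := y, 2 := z)"
  have p2: "lie_p T 2 g = commutator T (g 1) (g 2)" for g
    by (simp add: numeral_2_eq_2)
  have "\<phi> (lie_p T n x) = (\<Sum>i=1..2. lie_p T n (x(i := \<phi> (x i))))"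
    using two_le_n by (intro \<phi>_lie_p_tail_f) (auto simp: x_def)
  also have "\<dots> = lie_p T n (x(1 := \<phi> y)) + lie_p T n (x(2 := \<phi> z))"
    by (simp add: x_def numeral_2_eq_2 del: fun_upd_apply) (simp add: x_def)
  also have "lie_p T n (x(1 := \<phi> y)) = lie_p T 2 (x(1 := \<phi> y))"
    using two_le_n assms by (intro lie_p_tail_f) (auto simp: x_def p2)
  also have "lie_p T n (x(2 := \<phi> z)) = lie_p T 2 (x(2 := \<phi> z))"
    using two_le_n assms by (intro lie_p_tail_f) (auto simp: x_def p2)
  also have "lie_p T n x = lie_p T 2 x"
    using two_le_n assms by (intro lie_p_tail_f) (auto simp: x_def p2)
  finally show ?thesis by (simp add: p2 x_def)
qed

text \<open>A commutator with an element of \<open>M\<close> lies in \<open>M\<close>, so a third argument from \<open>M\<close> makes the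
  same idea work for arbitrary \<open>y\<close> and \<open>z\<close>.\<close>

lemma \<phi>_commutator_commutator_M:
  assumes "n \<ge> 3" and \<phi>_embM: "\<And>m. \<phi> (embM m) \<in> range embM"
  shows "\<phi> (commutator T (commutator T y z) (embM m)) =
    commutator T (commutator T (\<phi> y) z) (embM m) + commutator T (commutator T y (\<phi> z)) (embM m)
    + commutator T (commutator T y z) (\<phi> (embM m))"
proof -
  define x where "x = (\<lambda>_::nat. f)(1 := y, 2 := z, 3 := embM m)"
  have p3: "lie_p T 3 g = commutator T (commutator T (g 1) (g 2)) (g 3)" for g
    by (simp add: numeral_3_eq_3 numeral_2_eq_2)
  have "\<phi> (embM m) \<in> range embM" by (rule \<phi>_embM)
  then obtain m' where m': "\<phi> (embM m) = embM m'" by blast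
  have "\<phi> (lie_p T n x) = (\<Sum>i=1..3. lie_p T n (x(i := \<phi> (x i))))"
    using \<open>n \<ge> 3\<close> by (intro \<phi>_lie_p_tail_f) (auto simp: x_def)
  also have "\<dots> = lie_p T n (x(1 := \<phi> y)) + lie_p T n (x(2 := \<phi> z)) + lie_p T n (x(3 := embM m'))"
    by (simp add: x_def m' numeral_3_eq_3 numeral_2_eq_2 del: fun_upd_apply)
      (simp add: x_def m')
  also have "lie_p T n (x(1 := \<phi> y)) = lie_p T 3 (x(1 := \<phi> y))"
    using \<open>n \<ge> 3\<close> by (intro lie_p_tail_f) (auto simp: x_def p3 commutator_embM_right)
  also have "lie_p T n (x(2 := \<phi> z)) = lie_p T 3 (x(2 := \<phi> z))"
    using \<open>n \<ge> 3\<close> by (intro lie_p_tail_f) (auto simp: x_def p3 commutator_embM_right)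
  also have "lie_p T n (x(3 := embM m')) = lie_p T 3 (x(3 := embM m'))"
    using \<open>n \<ge> 3\<close> by (intro lie_p_tail_f) (auto simp: x_def p3 commutator_embM_right)
  also have "lie_p T n x = lie_p T 3 x"
    using \<open>n \<ge> 3\<close> by (intro lie_p_tail_f) (auto simp: x_def p3 commutator_embM_right)
  finally show ?thesis by (simp add: p3 x_def m')
qed

text \<open>The components of \<open>\<phi>\<close>. A prime marks those that map a diagonal corner into the opposite
  one.\<close>

definition \<alpha> :: "'a \<Rightarrow> 'a" where "\<alpha> a = fst (\<phi> (embA a))"

definition \<alpha>' :: "'a \<Rightarrow> 'b" where "\<alpha>' a = snd (snd (\<phi> (embA a)))"

definition \<beta> :: "'b \<Rightarrow> 'b" where "\<beta> b = snd (snd (\<phi> (embB b)))"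

definition \<beta>' :: "'b \<Rightarrow> 'a" where "\<beta>' b = fst (\<phi> (embB b))"

definition \<mu> :: "'m \<Rightarrow> 'm" where "\<mu> m = fst (snd (\<phi> (embM m)))"

lemma \<phi>_embM: "\<phi> (embM m) = embM (\<mu> m)"
proof -
  obtain a m' b where *: "\<phi> (embM m) = (a, m', b)" by (cases "\<phi> (embM m)")
  have "\<phi> (commutator T (embM m) f) = commutator T (\<phi> (embM m)) f + commutator T (embM m) (\<phi> f)"
    by (rule \<phi>_commutator_in_M) (simp_all add: * commutator_f commutator_embM_left)
  then show ?thesis
    by (simp add: commutator_f * \<mu>_def T.commutator_centre_right[OF \<phi>_f])
qed

lemma \<phi>_embA: "\<phi> (embA a) = (\<alpha> a, 0, \<alpha>' a)"
proof -
  obtain a' m b where *: "\<phi> (embA a) = (a', m, b)" by (cases "\<phi> (embA a)")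
  have 0: "commutator T (embA a) f = 0"
    by (simp add: embA_def commutator_f zero_prod_def)
  have "\<phi> (commutator T (embA a) f) = commutator T (\<phi> (embA a)) f + commutator T (embA a) (\<phi> f)"
    by (rule \<phi>_commutator_in_M)
      (simp_all add: * 0 commutator_f T.commutator_centre_right[OF \<phi>_f], simp_all add: zero_prod_def)
  then have "m = 0"
    by (simp add: 0 \<phi>_zero commutator_f * T.commutator_centre_right[OF \<phi>_f])
      (simp add: zero_prod_def)
  then show ?thesis by (simp add: * \<alpha>_def \<alpha>'_def)
qed

lemma \<phi>_embB: "\<phi> (embB b) = (\<beta>' b, 0, \<beta> b)"
proof -
  obtain a m b' where *: "\<phi> (embB b) = (a, m, b')" by (cases "\<phi> (embB b)")
  have 0: "commutator T (embB b) f = 0"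
    using commutator_f[of 0 0 b] by (simp add: embB_def zero_prod_def)
  have "\<phi> (commutator T (embB b) f) = commutator T (\<phi> (embB b)) f + commutator T (embB b) (\<phi> f)"
    by (rule \<phi>_commutator_in_M)
      (simp_all add: * 0 commutator_f T.commutator_centre_right[OF \<phi>_f], simp_all add: zero_prod_def)
  then have "m = 0"
    by (simp add: 0 \<phi>_zero commutator_f * T.commutator_centre_right[OF \<phi>_f])
      (simp add: zero_prod_def)
  then show ?thesis by (simp add: * \<beta>_def \<beta>'_def)
qed

lemma \<phi>_components: "\<phi> (a, m, b) = (\<alpha> a + \<beta>' b, \<mu> m, \<alpha>' a + \<beta> b)"
proof -
  have "(a, m, b) = embA a + embM m + embB b"
    by (simp add: embA_def embB_def)
  then show ?thesis by (simp add: \<phi>_add \<phi>_embA \<phi>_embB \<phi>_embM)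
qed

lemma \<mu>_hom: "module_hom (bscal M) (bscal M) \<mu>"
proof -
  interpret mA: module "scal A" by (rule A.module)
  interpret mB: module "scal B" by (rule B.module)
  have "\<mu> (m + m') = \<mu> m + \<mu> m'" for m m'
    using \<phi>_add[of "embM m" "embM m'"] by (simp add: \<phi>_embM)
  moreover have "\<mu> (bscal M r m) = bscal M r (\<mu> m)" for r m
    using \<phi>_scal[of r "embM m"] by (simp add: \<phi>_embM scal_triangular)
  ultimately show ?thesis
    by (intro module_hom.intro module module_hom_axioms.intro)
qed

lemma \<alpha>'_hom: "module_hom (scal A) (scal B) \<alpha>'"
proof -
  interpret mM: module "bscal M" by (rule module)
  interpret mB: module "scal B" by (rule B.module)
  have "\<alpha>' (a + a') = \<alpha>' a + \<alpha>' a'" for a a'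
    using \<phi>_add[of "embA a" "embA a'"] by (simp add: \<alpha>'_def embA_def)
  moreover have "\<alpha>' (scal A r a) = scal B r (\<alpha>' a)" for r a
    using \<phi>_scal[of r "embA a"] by (simp add: \<phi>_embA scal_triangular)
      (simp add: \<alpha>'_def embA_def scal_triangular)
  ultimately show ?thesis
    by (intro module_hom.intro A.module B.module module_hom_axioms.intro)
qed

lemma \<beta>'_hom: "module_hom (scal B) (scal A) \<beta>'"
proof -
  interpret mM: module "bscal M" by (rule module)
  interpret mA: module "scal A" by (rule A.module)
  have "\<beta>' (b + b') = \<beta>' b + \<beta>' b'" for b b'
    using \<phi>_add[of "embB b" "embB b'"] by (simp add: \<beta>'_def embB_def)
  moreover have "\<beta>' (scal B r b) = scal A r (\<beta>' b)" for r b
    using \<phi>_scal[of r "embB b"] by (simp add: \<phi>_embB scal_triangular)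
      (simp add: \<beta>'_def embB_def scal_triangular)
  ultimately show ?thesis
    by (intro module_hom.intro A.module B.module module_hom_axioms.intro)
qed

text \<open>The action of \<open>A\<close> on \<open>M\<close> is a commutator, \<open>a m = [a, m]\<close>, and so is that of \<open>B\<close>,
  \<open>m b = [m, b]\<close>.\<close>

lemma \<mu>_lact: "\<mu> (lact M a m) = lact M (\<alpha> a) m - ract M m (\<alpha>' a) + lact M a (\<mu> m)"
proof -
  have "\<phi> (commutator T (embA a) (embM m))
    = commutator T (\<phi> (embA a)) (embM m) + commutator T (embA a) (\<phi> (embM m))"
    by (rule \<phi>_commutator_in_M) (simp_all only: \<phi>_embM commutator_embM_right)
  then show ?thesis
    by (simp add: \<phi>_embA \<phi>_embM)
      (simp add: embA_def commutator_triangular act_simps \<phi>_components)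
qed

lemma \<mu>_ract: "\<mu> (ract M m b) = ract M (\<mu> m) b + ract M m (\<beta> b) - lact M (\<beta>' b) m"
proof -
  have "\<phi> (commutator T (embM m) (embB b))
    = commutator T (\<phi> (embM m)) (embB b) + commutator T (embM m) (\<phi> (embB b))"
    by (rule \<phi>_commutator_in_M) (simp_all only: \<phi>_embM commutator_embM_left)
  then show ?thesis
    by (simp add: \<phi>_embB \<phi>_embM)
      (simp add: embB_def commutator_triangular act_simps \<phi>_components)
qed

text \<open>If \<open>c a + \<alpha>' a\<close> and \<open>\<beta>' b + d b\<close> are central, then the primed terms in the formulas for \<open>\<mu>\<close>
  can be rewritten as actions from the other side and absorbed: \<open>\<alpha> - c\<close>, \<open>\<mu>\<close> and \<open>\<beta> - d\<close> are the
  components of a derivation.\<close>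

lemma standard_if_central_components:
  assumes A': "\<And>a. \<exists>c. (c, 0, \<alpha>' a) \<in> centre T" and B': "\<And>b. \<exists>d. (\<beta>' b, 0, d) \<in> centre T"
  shows "standard n T \<phi>"
proof -
  obtain c d where cd: "\<And>a. (c a, 0, \<alpha>' a) \<in> centre T" "\<And>b. (\<beta>' b, 0, d b) \<in> centre T"
    using A' B' by metis
  then have c: "ract M m (\<alpha>' a) = lact M (c a) m" and d: "lact M (\<beta>' b) m = ract M m (d b)" for a b m
    by (simp_all add: mem_centre_T_iff)
  define h where "h = (\<lambda>(a, m, b). (\<alpha> a - c a, \<mu> m, \<beta> b - d b))"
  have "derivation T h"
    unfolding h_def
    by (rule derivation_of_components) (simp_all add: \<mu>_hom \<mu>_lact \<mu>_ract c d act_simps)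
  moreover have "\<phi> x - h x \<in> centre T" for x
    by (cases x) (simp add: h_def \<phi>_components mem_centre_T_iff act_simps c d)
  ultimately show ?thesis by (rule T.standardI[OF two_le_n lie])
qed

text \<open>The Leibniz rule modulo \<open>A\<close> for the operators \<open>m \<mapsto> m (\<alpha>' a)\<close> comes from computing
  \<open>\<mu>((a b) m) = \<mu>(a (b m))\<close> in two ways.\<close>

lemma central_\<alpha>'_if_S_alg:
  assumes "S_alg A = UNIV"
  shows "\<exists>c. (c, 0, \<alpha>' a) \<in> centre T"
proof -
  have "\<exists>c. \<forall>m. ract M m (\<alpha>' a) = lact M c m"
  proof (rule A.S_alg_operators_in_image[OF assms, where s = "bscal M"])
    show "module_hom (scal A) (bscal M) (\<lambda>a. ract M m (\<alpha>' a))" for m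
      using module_hom_compose[OF \<alpha>'_hom ract_linear_right] by (simp add: o_def)
    show "\<exists>c. \<forall>m. lact M a (lact M b m) = lact M c m" for a b
      by (metis lact_mul)
    show "\<exists>c. \<forall>m. ract M m (\<alpha>' (mul A a b)) - lact M b (ract M m (\<alpha>' a))
      - lact M a (ract M m (\<alpha>' b)) = lact M c m" for a b
    proof (intro exI allI)
      fix m
      have "\<mu> (lact M (mul A a b) m) = \<mu> (lact M a (lact M b m))"
        by (simp add: act_simps)
      then show "ract M m (\<alpha>' (mul A a b)) - lact M b (ract M m (\<alpha>' a)) - lact M a (ract M m (\<alpha>' b))
        = lact M (\<alpha> (mul A a b) - mul A (\<alpha> a) b - mul A a (\<alpha> b)) m"
        unfolding \<mu>_lact by (simp add: act_simps algebra_simps)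
    qed
  qed (simp_all add: lact_linear_left lact_linear_right lact_mul)
  then show ?thesis by (auto simp: mem_centre_T_iff)
qed

lemma central_\<beta>'_if_S_alg:
  assumes "S_alg B = UNIV"
  shows "\<exists>d. (\<beta>' b, 0, d) \<in> centre T"
proof -
  have "\<exists>d. \<forall>m. lact M (\<beta>' b) m = ract M m d"
  proof (rule B.S_alg_operators_in_image[OF assms, where s = "bscal M"])
    show "module_hom (scal B) (bscal M) (\<lambda>b. lact M (\<beta>' b) m)" for m
      using module_hom_compose[OF \<beta>'_hom lact_linear_left] by (simp add: o_def)
    show "\<exists>c. \<forall>m. ract M (ract M m b) a = ract M m c" for a b
      by (metis ract_mul)
    show "\<exists>c. \<forall>m. lact M (\<beta>' (mul B a b)) m - ract M (lact M (\<beta>' a) m) b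
      - ract M (lact M (\<beta>' b) m) a = ract M m c" for a b
    proof (intro exI allI)
      fix m
      have "\<mu> (ract M m (mul B a b)) = \<mu> (ract M (ract M m a) b)"
        by (simp add: act_simps)
      then show "lact M (\<beta>' (mul B a b)) m - ract M (lact M (\<beta>' a) m) b - ract M (lact M (\<beta>' b) m) a
        = ract M m (\<beta> (mul B a b) - mul B (\<beta> a) b - mul B a (\<beta> b))"
        unfolding \<mu>_ract by (simp add: act_simps algebra_simps)
    qed
  qed (simp_all add: ract_linear_left ract_linear_right ract_mul)
  then show ?thesis by (metis mem_centre_T_iff)
qed

lemma embA_embB_leibniz:
  "commutator T (\<phi> (embA a)) (embB b) + commutator T (embA a) (\<phi> (embB b))
    = (commutator A a (\<beta>' b), 0, commutator B (\<alpha>' a) b)"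
  unfolding \<phi>_embA \<phi>_embB
  by (simp add: embA_def embB_def commutator_triangular act_simps A.commutator_zero_left
    B.commutator_zero_left) (simp add: commutator_def A.mul_zero_left A.mul_zero_right
    B.mul_zero_left B.mul_zero_right)

lemma embA_embB_commute: "commutator T (embA a) (embB b) = 0"
  by (simp add: embA_def embB_def commutator_triangular act_simps)
    (simp add: commutator_def A.mul_zero_left A.mul_zero_right B.mul_zero_left B.mul_zero_right zero_prod_def)

lemma commutators_zero_if_n_eq_2:
  assumes "n = 2"
  shows "commutator A a (\<beta>' b) = 0" "commutator B (\<alpha>' a) b = 0"
proof -
  define x where "x = (\<lambda>_::nat. f)(1 := embA a, 2 := embB b)"
  have "\<phi> (lie_p T 2 x) = (\<Sum>i=1..2. lie_p T 2 (x(i := \<phi> (x i))))"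
    using \<phi>_lie_p_tail_f[of 2 x] assms by simp
  then have "commutator T (\<phi> (embA a)) (embB b) + commutator T (embA a) (\<phi> (embB b)) = 0"
    by (simp add: numeral_2_eq_2 x_def embA_embB_commute \<phi>_zero)
  then show "commutator A a (\<beta>' b) = 0" "commutator B (\<alpha>' a) b = 0"
    unfolding embA_embB_leibniz by (simp_all add: zero_prod_def)
qed

text \<open>The sum \<open>y\<close> of the two commutators is what the Leibniz rule gives for \<open>[a, b] = 0\<close>. For
  \<open>n \<ge> 3\<close> the rule for \<open>[[a, b], m] = 0\<close> gives \<open>[y, m] = 0\<close> for all \<open>m \<in> M\<close>, which for diagonal
  elements is centrality.\<close>

lemma commutators_central: "(commutator A a (\<beta>' b), 0, commutator B (\<alpha>' a) b) \<in> centre T"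
proof (cases "n = 2")
  case True
  then show ?thesis by (simp add: commutators_zero_if_n_eq_2 mem_centre_T_iff act_simps)
next
  case False
  have "commutator T (commutator A a (\<beta>' b), 0, commutator B (\<alpha>' a) b) (embM m) = 0" for m
    using \<phi>_commutator_commutator_M[of "embA a" "embB b" m] False two_le_n
    by (simp add: \<phi>_embM embA_embB_commute T.commutator_zero_left \<phi>_zero
      flip: embA_embB_leibniz T.commutator_add_left)
  then show ?thesis
    by (simp add: commutator_triangular act_simps mem_centre_T_iff) (simp add: zero_prod_def)
qed

text \<open>A central element of \<open>T\<close> that lies in \<open>A\<close> annihilates \<open>M\<close>, hence is zero. So as soon as one
  component of the element in \<open>commutators_central\<close> vanishes, the other one does.\<close>

lemma \<beta>'_in_centre:
  assumes "\<And>a. \<alpha>' a \<in> centre B"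
  shows "\<beta>' b \<in> centre A"
proof -
  have "commutator A a (\<beta>' b) = 0" for a
    using commutators_central[of a b] B.commutator_centre_left[OF assms, of a b] faithful_left
    by (simp add: mem_centre_T_iff act_simps)
  then show ?thesis by (simp add: A.centre_iff_commutator)
qed

lemma \<alpha>'_in_centre:
  assumes "\<And>b. \<beta>' b \<in> centre A"
  shows "\<alpha>' a \<in> centre B"
proof -
  have "commutator B (\<alpha>' a) b = 0" for b
    using commutators_central[of a b] A.commutator_centre_right[OF assms, of a b] faithful_right
    by (simp add: mem_centre_T_iff act_simps)
  then show ?thesis by (simp add: centre_def commutator_def)
qed

text \<open>By \<open>commutators_central\<close>, all commutators of \<open>\<beta>' b\<close> with \<open>A\<close> are central in \<open>A\<close>, and all
  commutators of \<open>\<alpha>' a\<close> with \<open>B\<close> are central in \<open>B\<close>: this is the premise of property (P).\<close>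

lemma both_in_centre_if_property_P:
  assumes "n \<ge> 3 \<longrightarrow> property_P A \<or> property_P B"
  shows "\<alpha>' a \<in> centre B" "\<beta>' b \<in> centre A"
proof -
  have "(\<forall>a. \<alpha>' a \<in> centre B) \<or> (\<forall>b. \<beta>' b \<in> centre A)"
  proof (cases "n \<ge> 3")
    case False
    then show ?thesis
      using two_le_n commutators_zero_if_n_eq_2 by (auto simp: A.centre_iff_commutator)
  next
    case True
    then consider "property_P A" | "property_P B" using assms by blast
    then show ?thesis
    proof cases
      case 1
      have "commutator A (\<beta>' b) a \<in> centre A" for a b
      proof -
        have "commutator A (\<beta>' b) a = commutator A (- a) (\<beta>' b)"
          by (simp add: commutator_def module_hom.neg[OF A.linear_left]
            module_hom.neg[OF A.linear_right])
        then show ?thesis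
          using centre_T_imp_centre_A[OF commutators_central[of "- a" b]] by simp
      qed
      then show ?thesis using 1 by (simp add: property_P_def)
    next
      case 2
      then show ?thesis
        using centre_T_imp_centre_B[OF commutators_central] by (simp add: property_P_def)
    qed
  qed
  then show "\<alpha>' a \<in> centre B" "\<beta>' b \<in> centre A"
    using \<alpha>'_in_centre \<beta>'_in_centre by blast+
qed

end

section \<open>The general case\<close>

context faithful_bimodule
begin

text \<open>In the Leibniz rule for \<open>m = p\<^sub>n(m, f, \<dots>, f)\<close> the first summand is the component of \<open>\<phi> m\<close> in
  \<open>M\<close>, and each of the other \<open>n - 1\<close> summands is \<open>[m, \<phi> f] \<in> M\<close>. Comparing components in \<open>M\<close>
  leaves \<open>(n - 1) [m, \<phi> f] = 0\<close>.\<close>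

lemma commutator_M_\<phi>_f:
  assumes "n \<ge> 2" and "torsion_free (n - 1) T" and lie: "lie_n_derivation n T \<phi>"
  shows "commutator T (embM m) (\<phi> f) = 0"
proof -
  define x where "x = (\<lambda>_::nat. f)(1 := embM m)"
  define v where "v = commutator T (embM m) (\<phi> f)"
  obtain a m' b where \<phi>m: "\<phi> (embM m) = (a, m', b)" by (cases "\<phi> (embM m)")
  have v: "v \<in> range embM" unfolding v_def by (rule commutator_embM_left)
  have p2: "lie_p T 2 g = commutator T (g 1) (g 2)" for g
    by (simp add: numeral_2_eq_2)
  have "lie_p T n x = lie_p T 1 x"
    using \<open>n \<ge> 2\<close> by (intro lie_p_tail_f) (auto simp: x_def)
  then have "\<phi> (embM m) = \<phi> (lie_p T n x)" by (simp add: x_def)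
  also have "\<dots> = (\<Sum>i=1..n. lie_p T n (x(i := \<phi> (x i))))"
    using lie by (simp add: lie_n_derivation_def)
  also have "\<dots> = lie_p T n (x(1 := \<phi> (x 1))) + (\<Sum>i=2..n. lie_p T n (x(i := \<phi> (x i))))"
    using \<open>n \<ge> 2\<close> by (simp add: sum.atLeast_Suc_atMost numeral_2_eq_2)
  also have "lie_p T n (x(1 := \<phi> (x 1))) = lie_p T 2 (x(1 := \<phi> (x 1)))"
    using \<open>n \<ge> 2\<close> by (intro lie_p_tail_f) (auto simp: x_def p2 \<phi>m commutator_f)
  also have "\<dots> = embM m'"
    by (simp add: p2 x_def \<phi>m commutator_f)
  also have "(\<Sum>i=2..n. lie_p T n (x(i := \<phi> (x i)))) = (\<Sum>i=2..n. v)"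
  proof (rule sum.cong[OF refl])
    fix i assume i: "i \<in> {2..n}"
    then obtain j where j: "i = Suc j" "j \<ge> 1" by (cases i) auto
    have "lie_p T j (x(i := \<phi> (x i))) = lie_p T 1 (x(i := \<phi> (x i)))"
      using j by (intro lie_p_tail_f) (auto simp: x_def)
    then have "lie_p T i (x(i := \<phi> (x i))) = v"
      using j by (simp add: T.lie_p_Suc v_def x_def)
    moreover from this v have "lie_p T n (x(i := \<phi> (x i))) = lie_p T i (x(i := \<phi> (x i)))"
      using i by (intro lie_p_tail_f) (auto simp: x_def)
    ultimately show "lie_p T n (x(i := \<phi> (x i))) = v" by simp
  qed
  also have "\<dots> = (\<Sum>i<n-1. v)"
    by (rule sum.reindex_bij_witness[where i = "\<lambda>i. i + 2" and j = "\<lambda>i. i - 2"]) auto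
  finally have "(a, m', b) = embM m' + (\<Sum>i<n-1. v)" by (simp add: \<phi>m)
  then have "fst (snd (\<Sum>i<n-1. v)) = 0"
    by (metis add_cancel_left_right fst_conv fst_add snd_add snd_conv)
  moreover have "(\<Sum>i\<in>I. v) \<in> range embM" for I :: "nat set"
    using v by (induction I rule: infinite_finite_induct) (auto simp: zero_prod_def)
  ultimately have "(\<Sum>i<n-1. v) = 0"
    using image_iff[of "\<Sum>i<n-1. v" embM UNIV] by (auto simp: zero_prod_def)
  then show ?thesis using assms(2) unfolding torsion_free_def v_def[symmetric] by blast
qed

text \<open>The element \<open>\<phi> f\<close> commutes with \<open>M\<close>, so it is central up to its component \<open>m\<close> in \<open>M\<close>, and
  adding the inner derivation \<open>[_, m]\<close> removes this component.\<close>

lemma standard_reduction_central_f: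
  assumes "n \<ge> 2" and "torsion_free (n - 1) T" and lie: "lie_n_derivation n T \<phi>"
    and central: "\<And>\<psi>. lie_n_derivation n T \<psi> \<Longrightarrow> \<psi> f \<in> centre T \<Longrightarrow> standard n T \<psi>"
  shows "standard n T \<phi>"
proof -
  obtain a m b where \<phi>f: "\<phi> f = (a, m, b)" by (cases "\<phi> f")
  define d where "d = (\<lambda>x. commutator T x (embM m))"
  have d: "derivation T d" unfolding d_def by (rule T.derivation_inner)
  define \<psi> where "\<psi> x = \<phi> x + d x" for x
  have "lie_n_derivation n T \<psi>"
    unfolding \<psi>_def
    using \<open>n \<ge> 2\<close> by (intro T.lie_n_derivation_add lie T.derivation_lie_n_derivation d) simp
  moreover have "\<psi> f \<in> centre T"
  proof -
    have "lact M a m' = ract M m' b" for m'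
      using commutator_M_\<phi>_f[OF assms(1-3), of m']
      by (simp add: \<phi>f commutator_triangular zero_prod_def act_simps)
    moreover have "d f = (0, - m, 0)"
      by (simp add: d_def embB_def commutator_triangular act_simps)
        (simp add: commutator_def A.mul_zero_left B.mul_zero_left B.mul_zero_right)
    ultimately show ?thesis by (simp add: \<psi>_def \<phi>f mem_centre_T_iff)
  qed
  ultimately have "standard n T \<psi>" by (rule central)
  then obtain h \<tau> where h: "derivation T h" and "range \<tau> \<subseteq> centre T" "\<And>x. \<psi> x = h x + \<tau> x"
    unfolding standard_def by blast
  then have "\<phi> x - (h x - d x) \<in> centre T" for x
    using \<open>\<And>x. \<psi> x = h x + \<tau> x\<close>[of x] by (auto simp: \<psi>_def algebra_simps)
  then show ?thesis
    by (rule T.standardI[OF \<open>n \<ge> 2\<close> lie T.derivation_diff[OF h d]])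
qed

lemma S_alg_T_imp_S_alg_A: "S_alg T = UNIV \<Longrightarrow> S_alg A = UNIV"
  by (rule S_alg_surj_hom[OF T.unital_algebra_axioms A.unital_algebra_axioms, where \<pi> = fst])
    (auto simp: mul_triangular scal_triangular surj_def
      intro!: module_hom.intro T.module A.module module_hom_axioms.intro)

lemma S_alg_T_imp_S_alg_B: "S_alg T = UNIV \<Longrightarrow> S_alg B = UNIV"
  by (rule S_alg_surj_hom[OF T.unital_algebra_axioms B.unital_algebra_axioms,
        where \<pi> = "\<lambda>x. snd (snd x)"])
    (auto simp: mul_triangular scal_triangular surj_def
      intro!: module_hom.intro T.module B.module module_hom_axioms.intro)

end

theorem corollary3p6:
  fixes n :: nat
    and A :: "('r::comm_ring_1, 'a::ab_group_add) alg"
    and M :: "('r, 'a, 'm::ab_group_add, 'b::ab_group_add) bimod"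
    and B :: "('r, 'b) alg"
    and T :: "('r, 'a \<times> 'm \<times> 'b) alg"
    and e f :: "'a \<times> 'm \<times> 'b"
  assumes "n \<ge> 2"
    and "faithful_bimodule A B M"
    and "T = triangular A M B"
    and "e = embA (unit_el A)"
    and "f = embB (unit_el B)"
    and "torsion_free 2 T"
    and "torsion_free (n - 1) T"
    and "(S_alg A = UNIV \<and> S_alg B = UNIV)
      \<or> S_alg T = UNIV
      \<or> (S_alg A = UNIV \<and> embA ` centre A = corner T e (centre T))
      \<or> (S_alg B = UNIV \<and> embB ` centre B = corner T f (centre T))
      \<or> (embA ` centre A = corner T e (centre T) \<and> embB ` centre B = corner T f (centre T)
          \<and> (n \<ge> 3 \<longrightarrow> property_P A \<or> property_P B))"
  shows "\<forall>\<phi>. lie_n_derivation n T \<phi> \<longrightarrow> standard n T \<phi>"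
proof (intro allI impI)
  fix \<phi> assume \<phi>: "lie_n_derivation n T \<phi>"
  interpret faithful_bimodule A B M by fact
  note T = \<open>T = triangular A M B\<close> and e = \<open>e = embA (unit_el A)\<close> and f = \<open>f = embB (unit_el B)\<close>
  show "standard n T \<phi>"
    unfolding T
  proof (rule standard_reduction_central_f)
    fix \<psi> assume "lie_n_derivation n (triangular A M B) \<psi>"
      and "\<psi> (embB (unit_el B)) \<in> centre (triangular A M B)"
    then interpret lie_derivation_central_f A B M n \<psi>
      using \<open>n \<ge> 2\<close> by unfold_locales
    show "standard n (triangular A M B) \<psi>"
    proof (rule standard_if_central_components)
      fix a b
      consider (S) "S_alg A = UNIV" "S_alg B = UNIV"
        | (SA) "S_alg A = UNIV" "embA ` centre A = corner T e (centre T)"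
        | (SB) "S_alg B = UNIV" "embB ` centre B = corner T f (centre T)"
        | (Z) "embA ` centre A = corner T e (centre T)" "embB ` centre B = corner T f (centre T)"
          "n \<ge> 3 \<longrightarrow> property_P A \<or> property_P B"
        using assms(8) S_alg_T_imp_S_alg_A S_alg_T_imp_S_alg_B unfolding T by blast
      then have "(\<exists>c. (c, 0, \<alpha>' a) \<in> centre (triangular A M B))
        \<and> (\<exists>d. (\<beta>' b, 0, d) \<in> centre (triangular A M B))"
      proof cases
        case S
        then show ?thesis using central_\<alpha>'_if_S_alg central_\<beta>'_if_S_alg by blast
      next
        case SA
        then have "\<alpha>' a \<in> centre B" for a
          using central_\<alpha>'_if_S_alg centre_T_imp_centre_B by blast
        then show ?thesis
          using SA central_\<alpha>'_if_S_alg \<beta>'_in_centre corner_e_centre unfolding T e by blast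
      next
        case SB
        then have "\<beta>' b \<in> centre A" for b
          using central_\<beta>'_if_S_alg centre_T_imp_centre_A by blast
        then show ?thesis
          using SB central_\<beta>'_if_S_alg \<alpha>'_in_centre corner_f_centre unfolding T f by blast
      next
        case Z
        then show ?thesis
          using both_in_centre_if_property_P corner_e_centre corner_f_centre unfolding T e f by blast
      qed
      then show "\<exists>c. (c, 0, \<alpha>' a) \<in> centre (triangular A M B)"
        and "\<exists>d. (\<beta>' b, 0, d) \<in> centre (triangular A M B)" by blast+
    qed
  qed (use assms \<phi> in auto)
qed

end
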